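(* Let $q$ be a prime power, $d$ a positive integer, $n=(d-1)d+d-1=d^2-1$, $s$ a positive integer with $\gcd(s,n)=1$, and $\sigma\colon x\mapsto x^{q^s}$ on $\mathbb{F}_{q^n}$. Let $a,b\in\mathbb{F}_{q^n}$ and $L(x)=-x^{\sigma^d}+bx^{\sigma}+ax$, viewed as an $\mathbb{F}_q$-linear map on $\mathbb{F}_{q^n}$. If $q$ is even, $d$ is a power of $2$, $\mathrm{N}_{q^n/q}(a)=1$ and $b=a^{-\sigma^d\frac{\sigma^{d(d-1)}-1}{\sigma^d-1}}$, then $\dim_{\mathbb{F}_q}(\ker L)=d$.
   Context: $a^{-\sigma^d\frac{\sigma^{d(d-1)}-1}{\sigma^d-1}}$ denotes $\prod_{i=1}^{d-1}\sigma^{id}(a)^{-1}$. $\mathrm{N}_{q^n/q}$ is the field norm. *)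

theory Defs
  imports "HOL-Number_Theory.Number_Theory" "HOL-Library.Cardinality"
begin

text \<open>The extension of \<open>F\<^sub>q\<close> by \<open>F\<^bsub>q^n\<^esub>\<close> is given by an arbitrary embedding of a field with
  \<open>q\<close> elements into a field with \<open>q ^ n\<close> elements.\<close>

definition field_embedding :: "('k::field \<Rightarrow> 'a::field) \<Rightarrow> bool" where
  "field_embedding \<iota> \<longleftrightarrow>
     \<iota> 1 = 1 \<and> (\<forall>x y. \<iota> (x + y) = \<iota> x + \<iota> y) \<and> (\<forall>x y. \<iota> (x * y) = \<iota> x * \<iota> y)"

definition ext_scale :: "('k::field \<Rightarrow> 'a::field) \<Rightarrow> 'k \<Rightarrow> 'a \<Rightarrow> 'a" where
  "ext_scale \<iota> c x = \<iota> c * x"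

definition \<sigma> :: "nat \<Rightarrow> nat \<Rightarrow> 'a::field \<Rightarrow> 'a" where
  "\<sigma> q s x = x ^ (q ^ s)"

text \<open>The norm from the field with \<open>q ^ n\<close> elements to its subfield with \<open>q\<close> elements, as the product
  of the conjugates; its value is regarded as an element of the larger field.\<close>

definition field_norm :: "nat \<Rightarrow> nat \<Rightarrow> 'a::field \<Rightarrow> 'a" where
  "field_norm q n x = (\<Prod>i<n. x ^ (q ^ i))"

definition L :: "nat \<Rightarrow> nat \<Rightarrow> nat \<Rightarrow> 'a::field \<Rightarrow> 'a \<Rightarrow> 'a \<Rightarrow> 'a" where
  "L q s d a b x = - (\<sigma> q s ^^ d) x + b * \<sigma> q s x + a * x"

lemma vector_space_ext_scale:
  assumes "field_embedding \<iota>"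
  shows "vector_space (ext_scale \<iota>)"
  using assms
  by unfold_locales (auto simp: field_embedding_def ext_scale_def algebra_simps)

lemma linear_L:
  fixes \<iota> :: "'k::finite_field \<Rightarrow> 'a::finite_field"
  assumes q: "primepow q" "CARD('k) = q" and \<iota>: "field_embedding \<iota>"
  shows "Vector_Spaces.linear (ext_scale \<iota>) (ext_scale \<iota>) (L q s d a b)"
proof -
  interpret V: vector_space "ext_scale \<iota>"
    by (rule vector_space_ext_scale[OF \<iota>])
  have add: "\<iota> (x + y) = \<iota> x + \<iota> y" and mult: "\<iota> (x * y) = \<iota> x * \<iota> y" and one: "\<iota> 1 = 1" for x y
    using \<iota> by (auto simp: field_embedding_def)
  have zero: "\<iota> 0 = 0"
    using add[of 0 0] by (metis add_0 add_cancel_right_right)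
  have of_nat: "\<iota> (of_nat m) = of_nat m" for m
    by (induction m) (simp_all add: zero one add)
  have pow: "\<iota> (x ^ m) = \<iota> x ^ m" for x m
    by (induction m) (simp_all add: one mult)
  obtain p k where pk: "prime p" "q = p ^ k"
    using q(1) by (auto simp: primepow_def)
  have "prime CHAR('k)" "CHAR('k) dvd CARD('k)"
    using CHAR_dvd_CARD by (auto intro: prime_CHAR_semidom finite_imp_CHAR_pos)
  hence "CHAR('k) = p"
    using pk q(2) by (metis prime_dvd_power primes_dvd_imp_eq)
  moreover have "of_nat CHAR('k) = (0::'a)"
    using of_nat[of "CHAR('k)"] by (simp add: zero)
  hence "CHAR('a) dvd CHAR('k)"
    by (simp add: of_nat_eq_0_iff_char_dvd)
  moreover have "prime CHAR('a)"
    by (auto intro: prime_CHAR_semidom finite_imp_CHAR_pos)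
  ultimately have char: "CHAR('a) = p"
    using pk(1) by (metis primes_dvd_imp_eq)
  have \<sigma>_add: "\<sigma> q s (x + y) = \<sigma> q s x + \<sigma> q s y" for x y :: 'a
    unfolding \<sigma>_def
    by (rule freshmans_dream'[where n = "k * s"]) (use char pk in \<open>auto simp: power_mult\<close>)
  have \<sigma>_scale: "\<sigma> q s (\<iota> c * x) = \<iota> c * \<sigma> q s x" for c x
    using finite_field_power_card_power_eq_same[of "q ^ s" s c] q(2)
    by (simp add: \<sigma>_def power_mult_distrib flip: pow)
  have pow_add: "(\<sigma> q s ^^ m) (x + y) = (\<sigma> q s ^^ m) x + (\<sigma> q s ^^ m) y" for m and x y :: 'a
    by (induction m) (simp_all add: \<sigma>_add)
  have pow_scale: "(\<sigma> q s ^^ m) (\<iota> c * x) = \<iota> c * (\<sigma> q s ^^ m) x" for m c x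
    by (induction m) (simp_all add: \<sigma>_scale)
  show ?thesis
    by unfold_locales
      (simp_all add: L_def ext_scale_def \<sigma>_add \<sigma>_scale pow_add pow_scale ring_distribs mult.left_commute)
qed

end

theory Submission
  imports Defs "HOL-Computational_Algebra.Polynomial"
begin

text \<open>Put \<open>Q = q ^ s\<close>. Hilbert 90 for the generator \<open>\<sigma>\<^sup>d\<close> of the Galois group (\<open>d\<close> is prime to
  \<open>n = d\<^sup>2 - 1\<close>) writes \<open>a = \<lambda> ^ (Q ^ d) / \<lambda>\<close>; the product defining \<open>b\<close> then telescopes to
  \<open>\<lambda> ^ (Q ^ d) / \<lambda> ^ Q\<close>, so the substitution \<open>x = \<lambda> * y\<close> reduces the claim to \<open>a = b = 1\<close>.
  There \<open>L\<close> is the polynomial \<open>F = X ^ d + X + 1\<close> evaluated at \<open>\<sigma>\<close>. As \<open>d\<close> is a power of the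
  characteristic 2, \<open>F ^ d + F = X ^ (d\<^sup>2) + X\<close>, and hence \<open>F * G = X ^ n - 1\<close> for some \<open>G\<close>.
  A \<open>\<sigma>\<close>-polynomial of order \<open>m\<close> has at most \<open>q ^ m\<close> zeros; applied to \<open>F\<close> and to \<open>G\<close>, whose image
  lies in the kernel of \<open>F\<close>, this gives exactly \<open>q ^ d\<close> zeros of \<open>F\<close>.\<close>

section \<open>Counting along the fibres of a map\<close>

lemma card_le_fibre_bound:
  assumes "finite A" "\<And>y. y \<in> f ` A \<Longrightarrow> card {x \<in> A. f x = y} \<le> k"
  shows "card A \<le> k * card (f ` A)"
proof -
  have "card A = (\<Sum>y\<in>f ` A. card {x \<in> A. f x = y})"
    using sum.image_gen[OF assms(1), of "\<lambda>_. 1::nat" f] by simp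
  also have "\<dots> \<le> k * card (f ` A)"
    using sum_bounded_above[of "f ` A" "\<lambda>y. card {x \<in> A. f x = y}" k] assms(2) by (simp add: mult.commute)
  finally show ?thesis .
qed

text \<open>Subtracting \<open>x0\<close> carries the part of a fibre inside \<open>A\<close> into
  the kernel. As \<open>A\<close> is an arbitrary set, this yields an inequality and not an index
  formula.\<close>

lemma card_le_additive_image:
  fixes f :: "'a::{finite,ab_group_add} \<Rightarrow> 'b::ab_group_add"
  assumes "\<And>x y. f (x - y) = f x - f y"
  shows "card A \<le> card {x. f x = 0} * card (f ` A)"
proof (rule card_le_fibre_bound)
  fix y assume "y \<in> f ` A"
  then obtain x0 where x0: "y = f x0" by blast
  have "card {x \<in> A. f x = y} \<le> card {x. f x = 0}"
    by (rule card_inj_on_le[where f = "\<lambda>x. x - x0"]) (auto simp: assms x0 inj_on_def)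
  then show "card {x \<in> A. f x = y} \<le> card {x. f x = 0}" .
qed simp

section \<open>Bounding the zeros of a \<sigma>-polynomial\<close>

lemma power_power_Suc: "(x::'a::monoid_mult) ^ (Q ^ Suc i) = (x ^ Q) ^ (Q ^ i)"
  by (simp add: power_mult)

text \<open>Right division by \<sigma> - 1: with \<open>t i\<close> = \<sigma>^i(y), the quotient
  has the negated partial sums of \<open>c\<close> as coefficients, and the remainder is the total
  sum of \<open>c\<close>.\<close>

lemma summation_by_parts:
  fixes c t :: "nat \<Rightarrow> 'a::comm_ring"
  shows "(\<Sum>i\<le>m. (- (\<Sum>j\<le>i. c j)) * (t (Suc i) - t i)) + (\<Sum>j\<le>Suc m. c j) * t (Suc m)
         = (\<Sum>i\<le>Suc m. c i * t i)"
  by (induction m) (simp_all add: algebra_simps)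

lemma iterated_additive_power_diff:
  fixes x y :: "'a::comm_ring_1"
  assumes "\<And>x y :: 'a. (x + y) ^ Q = x ^ Q + y ^ Q"
  shows "(x - y) ^ (Q ^ i) = x ^ (Q ^ i) - y ^ (Q ^ i)"
proof (induction i arbitrary: x y)
  case (Suc i)
  have "(x - y) ^ Q = x ^ Q - y ^ Q" for x y :: 'a
    using assms[of "x - y" y] by (simp add: eq_diff_eq)
  then show ?case unfolding power_power_Suc by (simp add: Suc)
qed simp

text \<open>A nonzero zero \<open>u\<close> is moved to \<open>1\<close> by rescaling; then \<open>\<sigma> - 1\<close> splits off on the right,
  and its kernel is the fixed field.\<close>

lemma card_skew_poly_zeros_le:
  fixes c :: "nat \<Rightarrow> 'a::{finite,field}"
  assumes add: "\<And>x y :: 'a. (x + y) ^ Q = x ^ Q + y ^ Q"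
    and fixed: "card {x :: 'a. x ^ Q = x} \<le> q"
    and "c m \<noteq> 0"
  shows "card {x. (\<Sum>i\<le>m. c i * x ^ (Q ^ i)) = 0} \<le> q ^ m"
  using assms(3)
proof (induction m arbitrary: c)
  case 0
  then show ?case by simp
next
  case (Suc m)
  let ?K = "{x. (\<Sum>i\<le>Suc m. c i * x ^ (Q ^ i)) = 0}"
  show ?case
  proof (cases "?K \<subseteq> {0}")
    case True
    have "q \<ge> 1"
      using fixed card_mono[of "{x::'a. x ^ Q = x}" "{1}"] by simp
    then have "q ^ Suc m \<ge> 1" by (rule one_le_power)
    moreover have "card ?K \<le> 1" using True card_mono[of "{0}" ?K] by simp
    ultimately show ?thesis by linarith
  next
    case False
    then obtain u where u: "u \<noteq> 0" "(\<Sum>i\<le>Suc m. c i * u ^ (Q ^ i)) = 0" by blast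
    \<comment> \<open>These are the coefficients of \<open>y\<close> \<mapsto>
      P(\<open>u * y\<close>), P being the given \<sigma>-polynomial. Their sum is
      P(\<open>u\<close>) = 0, so 1 is a zero and the remainder on division by \<sigma> - 1
      vanishes; \<open>e\<close> holds the coefficients of the quotient.\<close>
    define c' where "c' i = c i * u ^ (Q ^ i)" for i
    define e where "e i = - (\<Sum>j\<le>i. c' j)" for i
    have sum0: "(\<Sum>j\<le>Suc m. c' j) = 0" using u(2) by (simp add: c'_def)
    have em: "e m \<noteq> 0"
    proof -
      have "e m = c' (Suc m)" using sum0 by (simp add: e_def add_eq_0_iff)
      then show ?thesis using Suc.prems u(1) by (simp add: c'_def)
    qed
    let ?K' = "{y. (\<Sum>i\<le>Suc m. c' i * y ^ (Q ^ i)) = 0}"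
    let ?E = "{z. (\<Sum>i\<le>m. e i * z ^ (Q ^ i)) = 0}"
    have "card ?K \<le> card ?K'"
    proof (rule card_inj_on_le[where f = "\<lambda>x. x / u"])
      have "c' i * (x / u) ^ (Q ^ i) = c i * x ^ (Q ^ i)" for i x
        using u(1) by (simp add: c'_def power_divide)
      then show "(\<lambda>x. x / u) ` ?K \<subseteq> ?K'"
        by (auto simp del: sum.atMost_Suc)
    qed (use u in \<open>auto simp: inj_on_def\<close>)
    also have "\<dots> \<le> card {x::'a. x ^ Q - x = 0} * card ((\<lambda>y. y ^ Q - y) ` ?K')"
      using iterated_additive_power_diff[OF add, where i = 1]
      by (intro card_le_additive_image) simp
    also have "\<dots> \<le> q * q ^ m"
    proof (rule mult_mono)
      show "card {x::'a. x ^ Q - x = 0} \<le> q" using fixed by simp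
      have "(\<Sum>i\<le>m. e i * (y ^ Q - y) ^ (Q ^ i)) = (\<Sum>i\<le>Suc m. c' i * y ^ (Q ^ i))" for y
        using summation_by_parts[of c' "\<lambda>i. y ^ (Q ^ i)" m] sum0
        by (simp add: e_def iterated_additive_power_diff[OF add] del: sum.atMost_Suc
                 flip: power_mult)
      then have "(\<lambda>y. y ^ Q - y) ` ?K' \<subseteq> ?E"
        by (auto simp del: sum.atMost_Suc)
      then have "card ((\<lambda>y. y ^ Q - y) ` ?K') \<le> card ?E" by (simp add: card_mono)
      then show "card ((\<lambda>y. y ^ Q - y) ` ?K') \<le> q ^ m"
        using Suc.IH[of e, OF em] by linarith
    qed simp_all
    finally show ?thesis by simp
  qed
qed

section \<open>Polynomials over the small field, evaluated at a power of Frobenius\<close>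

definition skew_eval :: "('k::field \<Rightarrow> 'a::field) \<Rightarrow> nat \<Rightarrow> 'k poly \<Rightarrow> 'a \<Rightarrow> 'a" where
  "skew_eval \<iota> Q p x = (\<Sum>i\<le>degree p. \<iota> (coeff p i) * x ^ (Q ^ i))"

lemma field_embedding_0: "field_embedding \<iota> \<Longrightarrow> \<iota> 0 = 0"
  unfolding field_embedding_def by (metis add_0 add_cancel_right_right)

lemma field_embedding_eq_0_iff:
  assumes "field_embedding \<iota>"
  shows "\<iota> x = 0 \<longleftrightarrow> x = 0"
proof
  assume "\<iota> x = 0"
  then show "x = 0"
    using assms unfolding field_embedding_def by (metis mult_zero_left right_inverse zero_neq_one)
qed (simp add: field_embedding_0[OF assms])

context
  fixes \<iota> :: "'k::field \<Rightarrow> 'a::field" and Q :: nat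
  assumes \<iota>: "field_embedding \<iota>"
    and additive: "\<And>x y :: 'a. (x + y) ^ Q = x ^ Q + y ^ Q"
    and fixes_range: "\<And>c. \<iota> c ^ Q = \<iota> c"
begin

private lemma \<iota>_simps: "\<iota> 0 = 0" "\<iota> 1 = 1" "\<iota> (c + c') = \<iota> c + \<iota> c'" "\<iota> (c * c') = \<iota> c * \<iota> c'"
  using \<iota> by (auto simp: field_embedding_0 field_embedding_def)

lemma skew_eval_0: "skew_eval \<iota> Q 0 x = 0"
  by (simp add: skew_eval_def \<iota>_simps)

lemma skew_eval_pCons: "skew_eval \<iota> Q (pCons c p) x = \<iota> c * x + skew_eval \<iota> Q p (x ^ Q)"
  \<comment> \<open>\<open>pCons\<close> raises the degree only for nonzero \<open>p\<close>, so the
    index shift in the sum needs \<open>p \<noteq> 0\<close>.\<close>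
  by (cases "p = 0")
    (simp_all add: skew_eval_def \<iota>_simps sum.atMost_Suc_shift power_mult del: sum.atMost_Suc)

lemma skew_eval_add: "skew_eval \<iota> Q (p + p') x = skew_eval \<iota> Q p x + skew_eval \<iota> Q p' x"
  by (induction p p' arbitrary: x rule: poly_induct2)
    (simp_all add: skew_eval_0 skew_eval_pCons \<iota>_simps algebra_simps)

lemma skew_eval_smult: "skew_eval \<iota> Q (smult c p) x = \<iota> c * skew_eval \<iota> Q p x"
  by (induction p arbitrary: x) (simp_all add: skew_eval_0 skew_eval_pCons \<iota>_simps algebra_simps)

lemma skew_eval_1: "skew_eval \<iota> Q 1 x = x"
  by (simp add: skew_eval_def \<iota>_simps)

lemma skew_eval_monom: "skew_eval \<iota> Q (monom 1 m) x = x ^ (Q ^ m)"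
  by (induction m arbitrary: x)
    (simp_all add: monom_0 monom_Suc skew_eval_0 skew_eval_pCons \<iota>_simps power_mult)

lemma skew_eval_diff_arg: "skew_eval \<iota> Q p (x - y) = skew_eval \<iota> Q p x - skew_eval \<iota> Q p y"
  by (simp add: skew_eval_def iterated_additive_power_diff[OF additive] algebra_simps sum_subtractf)

lemma skew_eval_power: "skew_eval \<iota> Q p x ^ Q = skew_eval \<iota> Q p (x ^ Q)"
proof (induction p arbitrary: x)
  case 0
  then show ?case using fixes_range[of 0] by (simp add: skew_eval_0 \<iota>_simps)
next
  case (pCons c p)
  then show ?case by (simp add: skew_eval_pCons additive power_mult_distrib fixes_range)
qed

text \<open>The scalars \<open>\<iota> c\<close> are fixed by the \<open>Q\<close>-th power, so
  evaluations commute with it (\<open>skew_eval_power\<close>). Hence composition is modelled by the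
  commutative product of \<open>'k poly\<close>, with no skew polynomial ring.\<close>

lemma skew_eval_mult: "skew_eval \<iota> Q (p * p') x = skew_eval \<iota> Q p (skew_eval \<iota> Q p' x)"
  by (induction p arbitrary: x)
    (simp_all add: skew_eval_0 skew_eval_pCons skew_eval_add skew_eval_smult skew_eval_power \<iota>_simps)

end

lemma card_skew_eval_zeros_le:
  fixes \<iota> :: "'k::field \<Rightarrow> 'a::{finite,field}"
  assumes "field_embedding \<iota>" "\<And>x y :: 'a. (x + y) ^ Q = x ^ Q + y ^ Q"
    and "card {x :: 'a. x ^ Q = x} \<le> q" "p \<noteq> 0"
  shows "card {x. skew_eval \<iota> Q p x = 0} \<le> q ^ degree p"
  unfolding skew_eval_def
  using assms by (intro card_skew_poly_zeros_le) (auto simp: field_embedding_eq_0_iff)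

text \<open>The upper bound is the general one for \<open>f\<close>. For the lower bound,
  \<open>g\<close> maps the whole field into the kernel of \<open>f\<close>, and the general bound
  on the kernel of \<open>g\<close> forces that image to be large.\<close>

lemma card_skew_eval_zeros_divisor:
  fixes \<iota> :: "'k::field \<Rightarrow> 'a::{finite,field}"
  assumes \<iota>: "field_embedding \<iota>" "\<And>x y :: 'a. (x + y) ^ Q = x ^ Q + y ^ Q" "\<And>c. \<iota> c ^ Q = \<iota> c"
    and fixed: "card {x :: 'a. x ^ Q = x} \<le> q"
    and card: "CARD('a) = q ^ degree (f * g)"
    and fg: "f * g \<noteq> 0" "\<And>x. skew_eval \<iota> Q (f * g) x = 0"
  shows "card {x. skew_eval \<iota> Q f x = 0} = q ^ degree f"
proof (rule antisym)
  show "card {x. skew_eval \<iota> Q f x = 0} \<le> q ^ degree f"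
    using fg by (intro card_skew_eval_zeros_le \<iota> fixed) auto
  have "q > 0" using fixed card_mono[of "{x::'a. x ^ Q = x}" "{1}"] by simp
  have deg: "degree (f * g) = degree g + degree f" using fg by (simp add: degree_mult_eq)
  have "q ^ degree g * q ^ degree f = card (UNIV :: 'a set)"
    by (simp add: card deg power_add)
  also have "\<dots> \<le> card {x. skew_eval \<iota> Q g x = 0} * card (range (skew_eval \<iota> Q g))"
    by (rule card_le_additive_image) (rule skew_eval_diff_arg[OF \<iota>])
  also have "\<dots> \<le> q ^ degree g * card {x. skew_eval \<iota> Q f x = 0}"
  proof (rule mult_mono)
    show "card {x. skew_eval \<iota> Q g x = 0} \<le> q ^ degree g"
      using fg by (intro card_skew_eval_zeros_le \<iota> fixed) auto
    have "range (skew_eval \<iota> Q g) \<subseteq> {x. skew_eval \<iota> Q f x = 0}"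
      using fg(2) by (auto simp: skew_eval_mult[OF \<iota>])
    then show "card (range (skew_eval \<iota> Q g)) \<le> card {x. skew_eval \<iota> Q f x = 0}"
      by (simp add: card_mono)
  qed simp_all
  finally show "q ^ degree f \<le> card {x. skew_eval \<iota> Q f x = 0}"
    using \<open>q > 0\<close> by simp
qed

section \<open>Fixed elements and Hilbert 90 in finite fields\<close>

lemma power_card_power_iterate:
  fixes x :: "'a::finite_field"
  assumes "CARD('a) = q ^ n"
  shows "x ^ (q ^ (n * j)) = x"
  using finite_field_power_card_power_eq_same[of "q ^ (n * j)" j x] assms by (simp add: power_mult)

lemma one_less_card_field: "CARD('a::finite_field) > 1"
proof -
  have "card {0, 1 :: 'a} \<le> CARD('a)" by (rule card_mono) auto
  then show ?thesis by simp
qed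

lemma one_less_base_if_card:
  assumes "CARD('a::finite_field) = q ^ n"
  shows "q > 1"
proof (rule ccontr)
  assume "\<not> q > 1"
  then have "q ^ n \<le> 1" by (intro power_le_one) auto
  then show False using one_less_card_field[where 'a = 'a] assms by simp
qed

text \<open>By Bezout some multiple of \<open>t\<close> is 1 modulo \<open>n\<close>, so iterating
  the \<open>q ^ t\<close>-th power that often gives the \<open>q\<close>-th power. The fixed
  elements are therefore roots of X^q - X.\<close>

lemma card_power_fixed_le:
  fixes q n t :: nat
  assumes card: "CARD('a::finite_field) = q ^ n" and "coprime t n" "t > 0" "n > 0"
  shows "card {x :: 'a. x ^ (q ^ t) = x} \<le> q"
proof -
  have "q > 1" using card one_less_base_if_card by blast
  obtain k j where kj: "t * k = n * j + 1"
    using bezout_nat[of t n] coprime_imp_gcd_eq_1[OF \<open>coprime t n\<close>] \<open>t > 0\<close> by auto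
  have "x ^ q = x" if x: "x ^ (q ^ t) = x" for x :: 'a
  proof -
    have "x ^ (q ^ (t * i)) = x" for i
      by (induction i) (simp_all add: power_add power_mult x)
    from this[of k] have "x = x ^ (q ^ (n * j) * q)"
      by (simp only: kj power_add power_one_right)
    then show ?thesis by (simp only: power_mult[of x] power_card_power_iterate[OF card])
  qed
  then have "{x :: 'a. x ^ (q ^ t) = x} \<subseteq> {x. poly (monom 1 q - monom 1 1) x = 0}"
    by (auto simp: poly_monom)
  then have "card {x :: 'a. x ^ (q ^ t) = x} \<le> card {x :: 'a. poly (monom 1 q - monom 1 1) x = 0}"
    by (simp add: card_mono)
  also have "\<dots> \<le> q"
  proof -
    have "coeff (monom 1 q - monom 1 1 :: 'a poly) q = 1" using \<open>q > 1\<close> by simp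
    then have "monom 1 q - monom 1 1 \<noteq> (0 :: 'a poly)" by (metis coeff_0 zero_neq_one)
    moreover have "degree (monom 1 q - monom 1 1 :: 'a poly) \<le> q"
      using \<open>q > 1\<close> by (intro degree_diff_le) (auto simp: degree_monom_eq)
    ultimately show ?thesis using card_poly_roots_bound order_trans by blast
  qed
  finally show ?thesis .
qed

text \<open>Hilbert 90 by counting: \<open>x \<mapsto> x ^ (q ^ t) / x\<close> has fibres of size at most \<open>q - 1\<close>, and its
  image lies among the at most \<open>(q ^ n - 1) / (q - 1)\<close> elements of norm 1.\<close>

lemma hilbert_90_power:
  fixes a :: "'a::finite_field"
  assumes card: "CARD('a) = q ^ n" and "coprime t n" "t > 0" "n > 0" "field_norm q n a = 1"
  obtains x where "x \<noteq> 0" "x ^ (q ^ t) = a * x"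
proof -
  \<comment> \<open>This is (q^n - 1) / (q - 1), the exponent of the norm, written as a geometric
    sum to avoid division.\<close>
  define M where "M = (\<Sum>i<n. q ^ i)"
  define N where "N = {x :: 'a. x ^ M = 1}"
  define h where "h x = x ^ (q ^ t) / x" for x :: 'a
  have "q > 0" using one_less_base_if_card[OF card] by simp
  then have "M > 0" using \<open>n > 0\<close> unfolding M_def by (auto intro!: sum_pos)
  have norm: "field_norm q n x = x ^ M" for x :: 'a
    by (simp add: field_norm_def M_def power_sum)
  have q_pow: "(q - 1) * M + 1 = q ^ n"
  proof -
    obtain r where "q = Suc r" using \<open>q > 0\<close> by (cases q) auto
    then show ?thesis unfolding M_def by (induction n) (simp_all add: algebra_simps)
  qed
  have norm_frob: "field_norm q n (x ^ q) = field_norm q n x" if "x \<noteq> 0" for x :: 'a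
  proof -
    \<comment> \<open>This is \<open>x ^ (q ^ n) = x\<close> read through
      \<open>q ^ n = (q - 1) * M + 1\<close>; it makes the norm invariant under the
      \<open>q\<close>-th power.\<close>
    have "(x ^ M) ^ (q - 1) * x = x"
      using power_card_power_iterate[OF card, of x 1] q_pow
      by (metis mult.commute mult.right_neutral power_add power_mult power_one_right)
    then have *: "(x ^ M) ^ (q - 1) = 1" using that by simp
    have "(x ^ M) ^ q = (x ^ M) ^ (q - 1) * x ^ M"
      using \<open>q > 0\<close> by (metis power_minus_mult)
    then show ?thesis using * by (simp add: norm power_mult[symmetric] mult.commute)
  qed
  have norm_frob_iter: "field_norm q n (x ^ (q ^ i)) = field_norm q n x" if "x \<noteq> 0" for x :: 'a and i
    by (induction i) (use that norm_frob in \<open>simp_all add: power_mult mult.commute[of q]\<close>)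
  have "h ` (- {0}) \<subseteq> N"
    using norm_frob_iter[of _ t] by (auto simp: h_def N_def norm power_divide)
  moreover have "card N \<le> M"
  proof -
    have "coeff (monom 1 M - 1 :: 'a poly) M = 1" using \<open>M > 0\<close> by simp
    then have "monom 1 M - 1 \<noteq> (0 :: 'a poly)" by (metis coeff_0 zero_neq_one)
    moreover have "degree (monom 1 M - 1 :: 'a poly) \<le> M"
      by (intro degree_diff_le) (auto simp: degree_monom_eq)
    moreover have "N = {x. poly (monom 1 M - 1) x = 0}" by (auto simp: N_def poly_monom)
    ultimately show ?thesis using card_poly_roots_bound order_trans by metis
  qed
  moreover have "M \<le> card (h ` (- {0}))"
  proof -
    have "card (- {0 :: 'a}) \<le> (q - 1) * card (h ` (- {0}))"
    proof (rule card_le_fibre_bound)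
      fix y assume "y \<in> h ` (- {0})"
      then obtain x0 where x0: "x0 \<noteq> 0" "y = h x0" by blast
      \<comment> \<open>Dividing by \<open>x0\<close> sends this fibre of \<open>h\<close> to
        nonzero fixed elements of the \<open>q ^ t\<close>-th power; removing 0 from at most
        \<open>q\<close> fixed elements leaves at most \<open>q - 1\<close>.\<close>
      have "card {x \<in> - {0}. h x = y} \<le> card ({x :: 'a. x ^ (q ^ t) = x} - {0})"
        using x0
        by (intro card_inj_on_le[where f = "\<lambda>x. x / x0"])
          (auto simp: inj_on_def h_def field_simps power_divide)
      also have "\<dots> \<le> q - 1"
        using card_power_fixed_le[OF assms(1-4)] \<open>q > 0\<close> by (simp add: card_Diff_singleton)
      finally show "card {x \<in> - {0}. h x = y} \<le> q - 1" .
    qed simp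
    moreover have "card (- {0 :: 'a}) = (q - 1) * M"
      using q_pow card by (simp add: Compl_eq_Diff_UNIV card_Diff_singleton)
    moreover have "q > 1" using card one_less_base_if_card by blast
    ultimately show ?thesis by simp
  qed
  ultimately have "h ` (- {0}) = N"
    by (intro card_seteq) auto
  moreover have "a \<in> N" using assms(5) by (simp add: N_def norm)
  ultimately obtain x where "x \<noteq> 0" "h x = a" by blast
  then show ?thesis using that[of x] by (simp add: h_def field_simps)
qed

section \<open>Iterates of \<sigma>, and the trinomial in characteristic 2\<close>

lemma sigma_funpow: "(\<sigma> q s ^^ m) x = x ^ ((q ^ s) ^ m)"
  by (induction m arbitrary: x) (simp_all add: \<sigma>_def funpow_swap1 power_mult mult.commute flip: power_mult)

lemma prod_inverse_telescope:
  fixes g :: "nat \<Rightarrow> 'a::field"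
  assumes "\<And>i. g i \<noteq> 0"
  shows "(\<Prod>i = 1..m. inverse (g (Suc i) / g i)) = g 1 / g (Suc m)"
  by (induction m) (use assms in \<open>simp_all add: field_simps\<close>)

lemma CHAR_eq_2_if_card:
  assumes "CARD('a::finite_field) = 2 ^ m"
  shows "CHAR('a) = 2"
proof -
  have "prime CHAR('a)"
    by (auto intro: prime_CHAR_semidom finite_imp_CHAR_pos)
  moreover have "CHAR('a) dvd 2 ^ m" using CHAR_dvd_CARD[where 'a = 'a] assms by simp
  ultimately show ?thesis
    by (metis prime_dvd_power primes_dvd_imp_eq two_is_prime_nat)
qed

text \<open>With \<open>?f\<close> the trinomial, \<open>?f ^ d - ?f\<close> equals X^(d^2) - X,
  because the \<open>d\<close>-th power is additive and the terms 1 and X^d cancel. Both sides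
  contain a factor X, on the left because \<open>?f ^ (d - 1) - 1\<close> vanishes at 0; cancelling
  it leaves \<open>g\<close>.\<close>

lemma trinomial_factor:
  fixes d k :: nat
  assumes char: "CHAR('k::field) = 2" and d: "d = 2 ^ k" "d > 1"
  obtains g :: "'k::field poly" where "(1 + monom 1 1 - monom 1 d) * g = monom 1 (d * d - 1) - 1"
proof -
  let ?f = "1 + monom 1 1 - monom 1 d :: 'k poly"
  have two: "(2::'k) = 0" using of_nat_CHAR[where 'a = 'k] char by simp
  have minus: "- p = p" for p :: "'k poly"
  proof -
    have "p + p = smult 2 p" by (metis one_add_one smult_1_left smult_add_left)
    then show ?thesis using two by (simp add: eq_neg_iff_add_eq_0)
  qed
  have frob: "(p + p') ^ d = p ^ d + p' ^ d" for p p' :: "'k poly"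
    by (rule freshmans_dream'[where n = k]) (use char d in auto)
  have f: "?f = 1 + monom 1 1 + monom 1 d" by (metis diff_conv_add_uminus minus)
  have "?f * (?f ^ (d - 1) - 1) = ?f ^ d - ?f"
    using d(2) by (simp add: right_diff_distrib power_eq_if[of _ d])
  also have "?f ^ d = 1 + monom 1 d + monom 1 (d * d)"
    unfolding f by (simp add: frob monom_power)
  also have "\<dots> - ?f = monom 1 (d * d) - monom 1 1"
    using minus by (simp add: f add_eq_0_iff) (metis add.commute diff_conv_add_uminus minus)
  also have "\<dots> = [:0, 1:] * (monom 1 (d * d - 1) - 1)"
    using d(2) by (cases "d * d") (auto simp: monom_Suc monom_0 algebra_simps one_pCons)
  finally have eq: "?f * (?f ^ (d - 1) - 1) = [:0, 1:] * (monom 1 (d * d - 1) - 1)" .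
  have "poly (?f ^ (d - 1) - 1) 0 = 0" using d(2) by (simp add: poly_monom zero_power)
  then have "[:0, 1:] dvd ?f ^ (d - 1) - 1" by (simp only: poly_eq_0_iff_dvd minus_zero)
  then obtain g where g: "?f ^ (d - 1) - 1 = [:0, 1:] * g"
    by (rule dvdE)
  have "[:0, 1:] * (?f * g) = [:0, 1:] * (monom 1 (d * d - 1) - 1)"
    using eq unfolding g by (simp add: mult.left_commute)
  then show ?thesis using that[of g] by simp
qed

lemma card_trinomial_kernel:
  fixes \<iota> :: "'k::field \<Rightarrow> 'a::{finite,field}"
  assumes \<iota>: "field_embedding \<iota>" "\<And>x y :: 'a. (x + y) ^ Q = x ^ Q + y ^ Q" "\<And>c. \<iota> c ^ Q = \<iota> c"
    and fixed: "card {x :: 'a. x ^ Q = x} \<le> q"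
    and d: "d = 2 ^ k" "d > 1" and char: "CHAR('k) = 2"
    and card: "CARD('a) = q ^ (d * d - 1)" and periodic: "\<And>x :: 'a. x ^ (Q ^ (d * d - 1)) = x"
  shows "card {x :: 'a. x + x ^ Q - x ^ (Q ^ d) = 0} = q ^ d"
proof -
  let ?f = "1 + monom 1 1 - monom 1 d :: 'k poly"
  obtain g :: "'k poly" where g: "?f * g = monom 1 (d * d - 1) - 1"
    using trinomial_factor[OF char d] .
  have eval_diff: "skew_eval \<iota> Q (p - p') x = skew_eval \<iota> Q p x - skew_eval \<iota> Q p' x" for p p' x
    using skew_eval_add[OF \<iota>, of "p - p'" p' x] by simp
  have "0 < d * d - 1" using d(2) by (metis less_1_mult zero_less_diff)
  then have deg: "degree (?f * g) = d * d - 1"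
    unfolding g using degree_add_eq_left[of "- 1" "monom 1 (d * d - 1) :: 'k poly"] by (simp add: degree_monom_eq)
  have "degree (1 + monom 1 1 :: 'k poly) \<le> 1"
    by (intro degree_add_le) (auto simp: degree_monom_eq)
  then have deg_f: "degree ?f = d"
    using d(2) degree_add_eq_right[of "1 + monom 1 1" "- monom 1 d :: 'k poly"] by (simp add: degree_monom_eq)
  have "card {x. skew_eval \<iota> Q ?f x = 0} = q ^ degree ?f"
  proof (rule card_skew_eval_zeros_divisor[OF \<iota> fixed])
    show "CARD('a) = q ^ degree (?f * g)" by (simp only: deg card)
    show "?f * g \<noteq> 0" using deg \<open>0 < d * d - 1\<close> by force
    show "skew_eval \<iota> Q (?f * g) x = 0" for x
      unfolding g by (simp add: eval_diff skew_eval_1[OF \<iota>] skew_eval_monom[OF \<iota>] periodic[unfolded One_nat_def])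
  qed
  then show ?thesis
    unfolding deg_f by (simp add: eval_diff skew_eval_add[OF \<iota>] skew_eval_1[OF \<iota>] skew_eval_monom[OF \<iota>])
qed

section \<open>From cardinality to dimension\<close>

lemma (in vector_space) card_span_independent:
  assumes "finite B" "independent B"
  shows "card (span B) = CARD('a) ^ card B"
  using assms
proof (induction B)
  case (insert v B)
  have "span (insert v B) = (\<lambda>(c, x). scale c v + x) ` (UNIV \<times> span B)"
    by (auto simp: span_insert image_iff) (metis add_diff_cancel_left' add_diff_eq diff_add_cancel add.commute)+
  moreover have "inj_on (\<lambda>(c, x). scale c v + x) (UNIV \<times> span B)"
  proof (rule inj_onI, clarify)
    fix c x c' x'
    assume x: "x \<in> span B" "x' \<in> span B" and eq: "scale c v + x = scale c' v + x'"
    have "scale (c - c') v = x' - x"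
      using eq by (simp add: scale_left_diff_distrib algebra_simps)
    then have "scale (c - c') v \<in> span B" using x by (simp add: span_diff)
    moreover have "v \<notin> span B" using insert by (simp add: independent_insert)
    ultimately have "c = c'"
      using span_scale[of "scale (c - c') v" B "inverse (c - c')"] by (cases "c = c'") auto
    then show "c = c' \<and> x = x'" using eq by simp
  qed
  ultimately show ?case
    using insert by (simp add: card_image card_cartesian_product independent_insert)
qed simp

lemma (in vector_space) dim_eq_if_card:
  assumes "subspace K" "finite K" "CARD('a) > 1" "card K = CARD('a) ^ m"
  shows "dim K = m"
proof -
  obtain B where B: "B \<subseteq> K" "independent B" "K \<subseteq> span B" "card B = dim K"
    using basis_exists by blast
  then have "span B = K" using assms(1) by (simp add: span_subspace)
  then have "CARD('a) ^ dim K = CARD('a) ^ m"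
    using card_span_independent[of B] B assms finite_subset by metis
  then show ?thesis using assms(3) by simp
qed

section \<open>Rescaling by a Hilbert 90 element and counting the kernel\<close>

theorem theorem5p1:
  fixes \<iota> :: "'k::finite_field \<Rightarrow> 'a::finite_field"
    and a b :: 'a
    and q d n s :: nat
  assumes "primepow q"
    and "d > 0"
    and "n = (d - 1) * d + d - 1"
    and "s > 0"
    and "gcd s n = 1"
    and "CARD('k) = q"
    and "CARD('a) = q ^ n"
    and "field_embedding \<iota>"
    and "even q"
    and "\<exists>k. d = 2 ^ k"
    and "field_norm q n a = 1"
    and "b = (\<Prod>i = 1..d - 1. inverse ((\<sigma> q s ^^ (i * d)) a))"
  shows "vector_space.dim (ext_scale \<iota>) {x. L q s d a b x = 0} = d"
proof -
  interpret V: vector_space "ext_scale \<iota>"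
    by (rule vector_space_ext_scale) fact
  define Q where "Q = q ^ s"
  obtain k where k: "d = 2 ^ k" using assms(10) by blast
  obtain e where e: "q = 2 ^ e"
    using assms(1,9) by (auto simp: primepow_def) (metis even_power prime_nat_iff' primes_dvd_imp_eq two_is_prime_nat)
  have card_gt: "CARD('a) > 1" "CARD('k) > 1" by (rule one_less_card_field)+
  \<comment> \<open>A field has more than one element, which excludes \<open>n = 0\<close>. Since
    \<open>d = 1\<close> would give \<open>n = 0\<close>, it follows that
    \<open>d > 1\<close>.\<close>
  then have "n \<noteq> 0" using assms(7) by (auto intro: ccontr)
  then have d: "d > 1" using assms(2,3) by (cases "d = 1") auto
  have n: "n = d * d - 1" "d * d = n + 1"
    using assms(3) d by (auto simp: diff_mult_distrib algebra_simps)
  have "coprime d n"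
  proof -
    have "coprime (d * d) n" using n(2) by (metis Suc_eq_plus1 coprime_Suc_left_nat)
    then show ?thesis by simp
  qed
  moreover have "coprime s n" using assms(5) by (rule gcd_eq_1_imp_coprime)
  ultimately have cop: "coprime s n" "coprime (s * d) n" by simp_all
  \<comment> \<open>Hilbert 90 is applied with \<open>t = s * d\<close>, as
    \<open>Q ^ d = q ^ (s * d)\<close>.\<close>
  obtain l where l: "l \<noteq> 0" "l ^ (Q ^ d) = a * l"
    using hilbert_90_power[OF assms(7) cop(2) _ _ assms(11)] \<open>n \<noteq> 0\<close> \<open>s > 0\<close> \<open>d > 0\<close> by (auto simp: Q_def simp flip: power_mult)
  have periodic: "x ^ (Q ^ n) = x" for x :: 'a
    using power_card_power_iterate[OF assms(7), of x s] by (simp add: Q_def mult.commute flip: power_mult)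
  have b: "b * l ^ Q = l ^ (Q ^ d)"
  proof -
    define g where "g i = l ^ (Q ^ (i * d))" for i
    have "a = l ^ (Q ^ d) / l" using l by simp
    then have "a ^ (Q ^ (i * d)) = g (Suc i) / g i" for i
      by (simp add: g_def power_divide power_add flip: power_mult)
    then have "b = g 1 / g (Suc (d - 1))"
      unfolding assms(12) using prod_inverse_telescope[of g "d - 1"] l(1)
      by (simp add: sigma_funpow g_def flip: Q_def)
    \<comment> \<open>The last index is \<open>d\<close>, and \<open>d * d = n + 1\<close>, so
      \<open>g d\<close> is \<sigma>^(n+1) applied to \<open>l\<close>; \<sigma>^n is the identity,
      which leaves \<open>l ^ Q\<close>.\<close>
    also have "g (Suc (d - 1)) = l ^ Q"
      using d periodic[of "l ^ Q"] by (simp add: g_def n(2) power_mult)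
    finally show ?thesis using l(1) by (simp add: g_def)
  qed
  \<comment> \<open>The three coefficients after the substitution, \<sigma>^d(l), b \<sigma>(l) and
    a l, all equal \<open>l ^ (Q ^ d)\<close>, which factors out and is nonzero.\<close>
  have L_scaled: "L q s d a b (l * y) = l ^ (Q ^ d) * (y + y ^ Q - y ^ (Q ^ d))" for y
  proof -
    have "L q s d a b (l * y) = - ((l * y) ^ (Q ^ d)) + b * l ^ Q * y ^ Q + (a * l) * y"
      by (simp add: L_def sigma_funpow \<sigma>_def power_mult_distrib mult.assoc flip: Q_def)
    then show ?thesis unfolding b l(2)[symmetric] by (simp add: algebra_simps power_mult_distrib)
  qed
  have "card {x. L q s d a b x = 0} = card {y :: 'a. y + y ^ Q - y ^ (Q ^ d) = 0}"
  proof (rule sym, rule bij_betw_same_card, rule bij_betw_byWitness)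
    show "(*) l ` {y. y + y ^ Q - y ^ (Q ^ d) = 0} \<subseteq> {x. L q s d a b x = 0}"
      by (auto simp: L_scaled)
    have "x / l + (x / l) ^ Q - (x / l) ^ (Q ^ d) = 0" if "L q s d a b x = 0" for x
      using L_scaled[of "x / l"] l(1) that by simp
    then show "(\<lambda>x. x / l) ` {x. L q s d a b x = 0} \<subseteq> {y. y + y ^ Q - y ^ (Q ^ d) = 0}"
      by blast
  qed (use l(1) in auto)
  also have "\<dots> = q ^ d"
  proof (rule card_trinomial_kernel[OF assms(8) _ _ _ k d])
    have char: "CHAR('a) = 2" using CHAR_eq_2_if_card[where 'a = 'a, of "e * n"] assms(7) e by (simp add: power_mult)
    show "(x + y) ^ Q = x ^ Q + y ^ Q" for x y :: 'a
      by (rule freshmans_dream'[where n = "e * s"]) (use char e in \<open>auto simp: Q_def power_mult\<close>)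
    have pow: "\<iota> (x ^ m) = \<iota> x ^ m" for x m
      using assms(8) by (induction m) (simp_all add: field_embedding_def)
    show "\<iota> c ^ Q = \<iota> c" for c
      using finite_field_power_card_power_eq_same[of Q s c] assms(6) by (simp add: Q_def flip: pow)
    show "card {x :: 'a. x ^ Q = x} \<le> q"
      unfolding Q_def using card_power_fixed_le[OF assms(7) cop(1)] \<open>n \<noteq> 0\<close> \<open>s > 0\<close> by simp
    show "CHAR('k) = 2" using CHAR_eq_2_if_card[where 'a = 'k] assms(6) e by simp
    show "CARD('a) = q ^ (d * d - 1)" using assms(7) n(1) by simp
    show "x ^ (Q ^ (d * d - 1)) = x" for x :: 'a using periodic n(1) by simp
  qed
  finally have "card {x. L q s d a b x = 0} = CARD('k) ^ d" using assms(6) by simp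
  moreover have "V.subspace {x. L q s d a b x = 0}"
  proof -
    interpret Vector_Spaces.linear "ext_scale \<iota>" "ext_scale \<iota>" "L q s d a b"
      by (rule linear_L) fact+
    show ?thesis by (rule subspace_kernel)
  qed
  ultimately show ?thesis
    using card_gt assms(6) by (intro V.dim_eq_if_card) auto
qed

end
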